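(* For every integer $n\ge 1$ there exists a continuous eigenvalue selection on $\mathrm{SU}(n)$, i.e. a continuous map $\varphi:\mathrm{SU}(n)\to\mathbb{S}^1$ with $\varphi(X)\in\mathrm{sp}(X)$ for all $X\in\mathrm{SU}(n)$. Consequently, for every integer $m\ge 1$, the assignment $X\mapsto\varphi(X)I_m$ is a continuous, commutativity-preserving and spectrum-shrinking map $\mathrm{SU}(n)\to M_m$.
   Context: $M_m$ is the algebra of $m\times m$ complex matrices with its usual topology, $I_m$ its identity, $\mathrm{SU}(n)$ the group of $n\times n$ unitary matrices of determinant $1$, $\mathbb{S}^1$ the unit circle in $\mathbb{C}$, and $\mathrm{sp}(X)$ the spectrum of $X$. A map $\phi:\mathrm{SU}(n)\to M_m$ is commutativity-preserving if $XY=YX$ implies $\phi(X)\phi(Y)=\phi(Y)\phi(X)$, and spectrum-shrinking if $\mathrm{sp}(\phi(X))\subseteq\mathrm{sp}(X)$ for all $X$. *)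

theory Defs
  imports "HOL-Analysis.Analysis"
begin

definition conjugate_transpose :: "complex^'n^'m \<Rightarrow> complex^'m^'n"
  where "conjugate_transpose X = map_matrix cnj (transpose X)"

definition unitary_matrix :: "complex^'n^'n \<Rightarrow> bool"
  where "unitary_matrix X \<longleftrightarrow>
    conjugate_transpose X ** X = mat 1 \<and> X ** conjugate_transpose X = mat 1"

definition SU :: "(complex^'n^'n) set"
  where "SU = {X. unitary_matrix X \<and> det X = 1}"

(* mat c is the scalar matrix c I, not a constant matrix. *)
definition spectrum :: "complex^'n^'n \<Rightarrow> complex set"
  where "spectrum X = {c. \<not> invertible (X - mat c)}"

(* Maps with domain SU(n) are encoded as total functions whose values outside SU are irrelevant. *)

definition continuous_eigenvalue_selection :: "(complex^'n^'n \<Rightarrow> complex) \<Rightarrow> bool"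
  where "continuous_eigenvalue_selection \<phi> \<longleftrightarrow>
    continuous_on SU \<phi> \<and> \<phi> \<in> SU \<rightarrow> sphere 0 1 \<and> (\<forall>X\<in>SU. \<phi> X \<in> spectrum X)"

definition commutativity_preserving :: "(complex^'n^'n \<Rightarrow> complex^'m^'m) \<Rightarrow> bool"
  where "commutativity_preserving \<Phi> \<longleftrightarrow>
    (\<forall>X\<in>SU. \<forall>Y\<in>SU. X ** Y = Y ** X \<longrightarrow> \<Phi> X ** \<Phi> Y = \<Phi> Y ** \<Phi> X)"

definition spectrum_shrinking :: "(complex^'n^'n \<Rightarrow> complex^'m^'m) \<Rightarrow> bool"
  where "spectrum_shrinking \<Phi> \<longleftrightarrow> (\<forall>X\<in>SU. spectrum (\<Phi> X) \<subseteq> spectrum X)"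

end

theory Submission
  imports Defs "HOL-Computational_Algebra.Fundamental_Theorem_Algebra"
begin

text \<open>
  The conjugacy class of a special unitary matrix has a canonical logarithm. Write its eigenvalues
  as \<open>angle (t $ j)\<close>, where \<open>angle x\<close> is the point of the unit circle at \<open>x\<close> full turns. Since
  the determinant is 1, the angles add up to an integer, and moving them by integers makes them
  add up to 0. Among the vectors \<open>t\<close> obtained in this way, one of minimal Euclidean norm has all its
  coordinates within distance 1 of each other (lemma \<open>exists_alcove_angles\<close>): otherwise a unit could
  be moved from a large coordinate to a small one. The set \<open>alcove\<close> of such vectors is, up to
  permutations, the fundamental alcove of the affine Weyl group of type A. It is compact, and on it
  the largest coordinate of \<open>t\<close> depends on the matrix only (lemma \<open>alcove_top_unique\<close>). The
  eigenvalue at the largest coordinate is the selection.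

  Continuity requires no perturbation theory. That the eigenvalues of \<open>X\<close> are given by \<open>t\<close> is the
  closed condition that the characteristic polynomial of \<open>X\<close> be the product of the corresponding
  linear factors, and \<open>t\<close> ranges over a compact set. A continuous function of \<open>t\<close> that is
  determined by \<open>X\<close> is then a continuous function of \<open>X\<close>, whether or not \<open>t\<close> itself can be chosen
  continuously (lemma \<open>continuous_on_fibre_constant\<close>).

  The second assertion is the fact that scalar matrices commute and that \<open>c I\<close> has spectrum
  \<open>{c}\<close>.
\<close>

section \<open>The characteristic polynomial of a complex matrix\<close>

text \<open>
  An enumeration of the eigenvalues with their algebraic multiplicities, by the index type of the
  matrix itself. The factors have the form \<open>l j - z\<close> so that \<open>z = 0\<close> gives the determinant
  without a sign.
\<close>

definition splitting :: "complex^'n^'n \<Rightarrow> ('n \<Rightarrow> complex) \<Rightarrow> bool"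
  where "splitting X l \<longleftrightarrow> (\<forall>z. det (X - mat z) = (\<Prod>j\<in>UNIV. l j - z))"

text \<open>
  The determinant is taken over the ring of polynomials. In the Leibniz expansion only the identity
  permutation picks all the diagonal entries, so the other summands have smaller degree.
\<close>

lemma characteristic_polynomial:
  fixes X :: "complex^'n^'n"
  obtains p where "\<And>z. poly p z = det (X - mat z)"
    and "degree p = CARD('n)" and "lead_coeff p = (-1) ^ CARD('n)"
proof -
  define M :: "complex poly^'n^'n"
    where "M = (\<chi> i j. if i = j then [:X$i$j, -1:] else [:X$i$j:])"
  define summand :: "('n \<Rightarrow> 'n) \<Rightarrow> complex poly" where "summand \<sigma> = of_int (sign \<sigma>) * (\<Prod>i\<in>UNIV. M $ i $ \<sigma> i)" for \<sigma>
  define d :: "complex poly" where "d = (\<Prod>i\<in>UNIV. [:X$i$i, -1:])"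
  define r where "r = (\<Sum>\<sigma>\<in>{\<sigma>. \<sigma> permutes (UNIV :: 'n set)} - {id}. summand \<sigma>)"
  have "summand id = d"
    by (simp add: summand_def d_def M_def sign_id)
  then have det_M: "det M = d + r"
    unfolding r_def det_def
    by (subst sum.remove[of _ id]) (auto simp: summand_def permutes_id)
  have deg_d: "degree d = CARD('n)"
    unfolding d_def by (subst degree_prod_eq_sum_degree) auto
  have lead_d: "lead_coeff d = (-1) ^ CARD('n)"
    unfolding d_def by (subst lead_coeff_prod) simp
  have "degree (summand \<sigma>) < CARD('n)" if "\<sigma> permutes UNIV" "\<sigma> \<noteq> id" for \<sigma> :: "'n \<Rightarrow> 'n"
  proof -
    from that(2) obtain k where k: "\<sigma> k \<noteq> k" by (auto simp: fun_eq_iff)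
    have "degree (summand \<sigma>) \<le> degree (\<Prod>i\<in>UNIV. M $ i $ \<sigma> i)"
      unfolding summand_def by (rule order_trans[OF degree_mult_le]) simp
    also have "\<dots> \<le> (\<Sum>i\<in>UNIV. degree (M $ i $ \<sigma> i))"
      using degree_prod_sum_le[of UNIV "\<lambda>i. M $ i $ \<sigma> i"] by (simp add: o_def)
    also have "\<dots> < (\<Sum>i\<in>(UNIV :: 'n set). 1)"
      by (rule sum_strict_mono_ex1) (use k in \<open>auto simp: M_def intro!: exI[of _ k]\<close>)
    finally show ?thesis by simp
  qed
  then have deg_r: "degree r < CARD('n)"
    unfolding r_def by (intro degree_sum_less) auto
  show thesis
  proof
    fix z
    have entry: "poly (M $ i $ j) z = (X - mat z) $ i $ j" for i j
      by (simp add: M_def mat_def)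
    show "poly (det M) z = det (X - mat z)"
      by (simp add: det_def poly_sum poly_prod entry)
  next
    show "degree (det M) = CARD('n)"
      using deg_r deg_d by (simp add: det_M degree_add_eq_left)
    show "lead_coeff (det M) = (-1) ^ CARD('n)"
      using deg_r deg_d lead_d by (simp add: det_M degree_add_eq_left coeff_eq_0)
  qed
qed

lemma complex_poly_splits:
  assumes "finite A" and "degree (p :: complex poly) = card A"
  shows "\<exists>l c. p = smult c (\<Prod>a\<in>A. [:l a, -1:])"
  using assms
proof (induction A arbitrary: p rule: finite_induct)
  case empty
  then show ?case by (auto elim!: degree_eq_zeroE)
next
  case (insert a A)
  then have "\<not> constant (poly p)" by (simp add: constant_degree)
  then obtain z where "poly p z = 0"
    using fundamental_theorem_of_algebra by blast
  then obtain q where q: "p = [:-z, 1:] * q"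
    by (auto simp: poly_eq_0_iff_dvd)
  with insert have "q \<noteq> 0" by auto
  then have "degree p = 1 + degree q"
    unfolding q by (subst degree_mult_eq) auto
  with insert.prems insert.hyps have "degree q = card A" by simp
  then obtain l c where lc: "q = smult c (\<Prod>a\<in>A. [:l a, -1:])"
    using insert.IH by blast
  have "(\<Prod>b\<in>A. [:(l(a := z)) b, -1:]) = (\<Prod>b\<in>A. [:l b, -1:])"
    using insert.hyps by (intro prod.cong) auto
  then have "(\<Prod>b\<in>insert a A. [:(l(a := z)) b, -1:]) = [:z, -1:] * (\<Prod>b\<in>A. [:l b, -1:])"
    using insert.hyps by simp
  moreover have "[:-z, 1:] = - [:z, -1:]" by simp
  ultimately have "p = smult (- c) (\<Prod>b\<in>insert a A. [:(l(a := z)) b, -1:])"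
    unfolding q lc by (simp only: mult_minus_left mult_smult_right smult_minus_left smult_minus_right)
  then show ?case by blast
qed

lemma splitting_exists:
  fixes X :: "complex^'n^'n"
  obtains l where "splitting X l"
proof -
  obtain p where p: "\<And>z. poly p z = det (X - mat z)"
      "degree p = CARD('n)" "lead_coeff p = (-1) ^ CARD('n)"
    using characteristic_polynomial[of X] by blast
  then obtain l c where lc: "p = smult c (\<Prod>a\<in>(UNIV :: 'n set). [:l a, -1:])"
    using complex_poly_splits[of "UNIV :: 'n set" p] by auto
  have "lead_coeff p = c * (-1) ^ CARD('n)"
    unfolding lc lead_coeff_smult lead_coeff_prod by simp
  with p(3) have "c = 1" by simp
  then have "splitting X l"
    unfolding splitting_def p(1)[symmetric] lc by (simp add: poly_prod)
  then show thesis ..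
qed

text \<open>
  The order of the enumeration is the only freedom, by unique factorisation; the multiplicities
  are compared through the multisets of roots.
\<close>

lemma splitting_unique:
  fixes X :: "complex^'n^'n"
  assumes "splitting X l" and "splitting X l'"
  obtains \<pi> where "\<pi> permutes UNIV" and "\<And>j. l j = l' (\<pi> j)"
proof -
  have neg: "(\<Prod>j\<in>UNIV. z - f j) = (-1) ^ CARD('n) * (\<Prod>j\<in>UNIV. f j - z)"
    for f :: "'n \<Rightarrow> complex" and z
    by (simp flip: prod_constant prod.distrib)
  have "poly (\<Prod>j\<in>UNIV. [:- l j, 1:]) = poly (\<Prod>j\<in>UNIV. [:- l' j, 1:])"
    using assms by (auto simp: fun_eq_iff poly_prod splitting_def neg)
  then have "proots (\<Prod>j\<in>UNIV. [:- l j, 1:]) = proots (\<Prod>j\<in>UNIV. [:- l' j, 1:])"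
    by (simp add: poly_eq_poly_eq_iff)
  then have "image_mset l (mset_set UNIV) = image_mset l' (mset_set UNIV)"
    by (simp add: proots_prod sum_unfold_sum_mset)
  then show thesis
    using image_mset_eq_implies_permutes[of UNIV l l'] that by auto
qed

lemma mem_spectrum_iff_det: "c \<in> spectrum X \<longleftrightarrow> det (X - mat c) = 0"
  by (simp add: spectrum_def invertible_det_nz)

lemma splitting_spectrum:
  assumes "splitting X l"
  shows "spectrum X = range l"
  using assms by (auto simp: mem_spectrum_iff_det splitting_def prod_zero_iff)

lemma splitting_prod:
  assumes "splitting X l"
  shows "(\<Prod>j\<in>UNIV. l j) = det X"
proof -
  have "det (X - mat 0) = (\<Prod>j\<in>UNIV. l j - 0)"
    using assms unfolding splitting_def by blast
  then show ?thesis by simp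
qed

section \<open>Eigenvalues of unitary matrices\<close>

text \<open>
  A unitary matrix preserves the Hermitian form \<open>h\<close>, and on an eigenvector it multiplies
  \<open>h v v\<close> by \<open>c * cnj c\<close>.
\<close>

lemma unitary_spectrum_norm:
  fixes X :: "complex^'n^'n"
  assumes "unitary_matrix X" and "c \<in> spectrum X"
  shows "norm c = 1"
proof -
  have "\<not> invertible (X - mat c)" using assms(2) by (simp add: spectrum_def)
  then obtain v where v: "(X - mat c) *v v = 0" "v \<noteq> 0"
    by (auto simp: invertible_left_inverse matrix_left_invertible_ker)
  have Xv: "X *v v = c *s v"
  proof -
    have "mat c *v v = c *s v"
      by (simp add: vec_eq_iff matrix_vector_mult_def mat_def if_distrib[of "\<lambda>x. x * _"] cong: if_cong)
    with v(1) show ?thesis by (simp add: matrix_vector_mult_diff_rdistrib)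
  qed
  define h :: "complex^'n \<Rightarrow> complex^'n \<Rightarrow> complex" where "h u w = (\<Sum>i\<in>UNIV. cnj (u $ i) * w $ i)" for u w
  have adjoint: "h (X *v u) w = h u (conjugate_transpose X *v w)" for u w
    unfolding h_def matrix_vector_mult_def conjugate_transpose_def map_matrix_def transpose_def
    by (simp add: sum_distrib_left sum_distrib_right mult_ac, subst sum.swap, rule refl)
  have hvv: "h v v = of_real (\<Sum>i\<in>UNIV. (norm (v $ i))\<^sup>2)"
    unfolding h_def of_real_sum complex_norm_square by (simp add: mult.commute)
  have "h (X *v v) (X *v v) = h v (conjugate_transpose X ** X *v v)"
    by (simp add: adjoint matrix_vector_mul_assoc)
  also have "\<dots> = h v v"
    using assms(1) by (simp add: unitary_matrix_def)
  finally have "h (c *s v) (c *s v) = h v v" by (simp add: Xv)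
  moreover have "h (c *s v) (c *s v) = (c * cnj c) * h v v"
    by (simp add: h_def sum_distrib_left mult_ac)
  moreover have "h v v \<noteq> 0"
    using v(2) unfolding hvv of_real_eq_0_iff
    by (subst sum_nonneg_eq_0_iff) (auto simp: vec_eq_iff)
  ultimately have "c * cnj c = 1" by simp
  then have "complex_of_real ((norm c)\<^sup>2) = 1"
    unfolding complex_norm_square .
  then have "(norm c)\<^sup>2 = 1" by (simp only: of_real_eq_1_iff)
  then show ?thesis by (simp add: abs_square_eq_1)
qed

section \<open>Normalised angles\<close>

definition angle :: "real \<Rightarrow> complex"
  where "angle x = cis (2 * pi * x)"

text \<open>
  The usual alcove consists of the decreasing vectors in this set. Without the ordering no sorting
  is needed, and the largest coordinate takes the place of the first one.
\<close>

definition alcove :: "(real^'n) set"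
  where "alcove = {t. (\<Sum>j\<in>UNIV. t $ j) = 0 \<and> (\<forall>i j. t $ i - t $ j \<le> 1)}"

definition top_coord :: "real^'n \<Rightarrow> real"
  where "top_coord t = Max (range (($) t))"

lemma angle_eq_iff: "angle x = angle y \<longleftrightarrow> x - y \<in> \<int>"
proof
  assume "angle x = angle y"
  then have "sin (2 * pi * x) = sin (2 * pi * y) \<and> cos (2 * pi * x) = cos (2 * pi * y)"
    by (simp add: angle_def complex_eq_iff)
  then obtain n :: int where "2 * pi * x = 2 * pi * y + 2 * pi * n"
    unfolding sin_cos_eq_iff by auto
  then have "2 * pi * x = 2 * pi * (y + n)" by (simp add: algebra_simps)
  then have "x - y = n" by simp
  then show "x - y \<in> \<int>" by simp
next
  assume "x - y \<in> \<int>"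
  then obtain n :: int where "x = y + n" by (metis Ints_cases diff_add_cancel add.commute)
  then have "2 * pi * x = 2 * pi * y + 2 * pi * n" by (simp add: algebra_simps)
  then show "angle x = angle y"
    unfolding angle_def complex_eq_iff by (simp, metis sin_cos_eq_iff)
qed

lemma angle_sum: "angle (\<Sum>j\<in>A. f j) = (\<Prod>j\<in>A. angle (f j))"
  by (induction A rule: infinite_finite_induct)
    (simp_all add: angle_def distrib_left flip: cis_mult)

lemma norm_1_eq_angle:
  assumes "norm z = 1"
  obtains x where "z = angle x"
proof
  have "z = cis (Arg z)"
    using assms by (metis cis_Arg norm_zero sgn_div_norm scaleR_one inverse_1 zero_neq_one)
  then show "z = angle (Arg z / (2 * pi))" by (simp add: angle_def)
qed

lemma coord_le_top: "t $ i \<le> top_coord t"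
  by (simp add: top_coord_def)

lemma top_coord_attained: obtains i where "top_coord t = t $ i"
proof -
  have "Max (range (($) t)) \<in> range (($) t)" by (rule Max_in) auto
  then obtain i where "Max (range (($) t)) = t $ i" by blast
  then show thesis by (intro that) (simp add: top_coord_def)
qed

lemma continuous_on_top_coord: "continuous_on S top_coord"
proof -
  have le: "top_coord s \<le> top_coord t + dist s t" for s t :: "real^'n"
  proof -
    obtain i where "top_coord s = s $ i" by (rule top_coord_attained)
    moreover have "s $ i - t $ i \<le> dist s t"
      using dist_vec_nth_le[of s i t] by (simp add: dist_real_def)
    ultimately show ?thesis using coord_le_top[of t i] by simp
  qed
  have "dist (top_coord s) (top_coord t) \<le> dist s t" for s t :: "real^'n"
    using le[of s t] le[of t s] by (simp add: dist_real_def dist_commute abs_le_iff)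
  then show ?thesis
    unfolding continuous_on_iff by (meson order_le_less_trans)
qed

text \<open>
  As the coordinates add up to 0, some coordinate is nonpositive and some is nonnegative. The bound
  on the differences then bounds every coordinate.
\<close>

lemma compact_alcove: "compact (alcove :: (real^'n) set)"
proof -
  have "\<bar>t $ i\<bar> \<le> 1" if "t \<in> alcove" for t :: "real^'n" and i
  proof -
    have sum0: "(\<Sum>j\<in>UNIV. t $ j) = 0" and le: "\<And>i j. t $ i - t $ j \<le> 1"
      using that by (auto simp: alcove_def)
    have "\<exists>j. t $ j \<le> 0"
      using sum_pos[of UNIV "($) t"] sum0 by (force simp: not_le)
    moreover have "\<exists>j. t $ j \<ge> 0"
      using sum_pos[of UNIV "\<lambda>j. - t $ j"] sum0 by (force simp: not_le sum_negf)
    ultimately show ?thesis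
      using le by (smt (verit))
  qed
  then have "(alcove :: (real^'n) set) \<subseteq> cbox (\<chi> i. -1) (\<chi> i. 1)"
    by (auto simp: mem_box_cart abs_le_iff minus_le_iff)
  then have "bounded (alcove :: (real^'n) set)"
    using bounded_cbox bounded_subset by blast
  moreover have "closed (alcove :: (real^'n) set)"
    unfolding alcove_def
    by (intro closed_Collect_conj closed_Collect_all closed_Collect_eq closed_Collect_le continuous_intros)
  ultimately show ?thesis by (simp add: compact_eq_bounded_closed)
qed

text \<open>
  The vectors of angles of \<open>l\<close> with coordinate sum 0 form a closed set \<open>L\<close>, which contains a point
  \<open>t\<close> nearest to the origin. If \<open>t $ i - t $ j > 1\<close>, then moving a unit from \<open>i\<close> to \<open>j\<close> stays
  in \<open>L\<close> and changes the squared norm by \<open>2 * (1 - (t $ i - t $ j)) < 0\<close>.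
\<close>

lemma exists_alcove_angles:
  fixes l :: "'n::finite \<Rightarrow> complex"
  assumes "\<And>j. norm (l j) = 1" and "(\<Prod>j\<in>UNIV. l j) = 1"
  obtains t where "t \<in> alcove" and "\<And>j. l j = angle (t $ j)"
proof -
  define L where "L = {t :: real^'n. (\<Sum>j\<in>UNIV. t $ j) = 0 \<and> (\<forall>j. angle (t $ j) = l j)}"
  have "\<forall>j. \<exists>x. l j = angle x"
    using assms(1) norm_1_eq_angle by metis
  then obtain f where f: "\<And>j. l j = angle (f j)" by metis
  define s where "s = (\<Sum>j\<in>UNIV. f j)"
  have "angle s = angle 0"
    using assms(2) by (simp add: s_def angle_sum flip: f) (simp add: angle_def)
  then have "s \<in> \<int>" by (simp add: angle_eq_iff)
  obtain k :: 'n where True by simp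
  \<comment> \<open>The whole integer sum \<open>s\<close> is subtracted from one coordinate.\<close>
  have "(\<chi> j. f j - (if j = k then s else 0)) \<in> L"
    using \<open>s \<in> \<int>\<close> by (auto simp: L_def sum_subtractf s_def[symmetric] f angle_eq_iff)
  then have "L \<noteq> {}" by auto
  moreover have "closed L"
    unfolding L_def angle_def
    by (intro closed_Collect_conj closed_Collect_all closed_Collect_eq continuous_intros)
  ultimately obtain t where t: "t \<in> L" and "\<And>u. u \<in> L \<Longrightarrow> dist 0 t \<le> dist 0 u"
    using distance_attains_inf by blast
  then have min: "u \<in> L \<Longrightarrow> t \<bullet> t \<le> u \<bullet> u" for u
    by (simp add: norm_le)
  have "t $ i - t $ j \<le> 1" for i j
  proof (rule ccontr)
    assume gt: "\<not> t $ i - t $ j \<le> 1"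
    then have "i \<noteq> j" by auto
    define w :: "real^'n" where "w = axis j 1 - axis i 1"
    have w: "w $ m \<in> \<int>" for m by (simp add: w_def axis_def)
    have "(\<Sum>m\<in>UNIV. w $ m) = 0"
      by (simp add: w_def axis_def sum_subtractf)
    moreover have "angle ((t + w) $ m) = angle (t $ m)" for m
      using w by (simp add: angle_eq_iff)
    ultimately have "t + w \<in> L"
      using t by (simp add: L_def sum.distrib)
    moreover have "(t + w) \<bullet> (t + w) = t \<bullet> t + 2 * (1 - (t $ i - t $ j))"
      using \<open>i \<noteq> j\<close>
      by (simp add: w_def inner_simps inner_axis inner_axis' inner_commute) (simp add: axis_def)
    ultimately show False using min gt by fastforce
  qed
  then have "t \<in> alcove" using t by (simp add: alcove_def L_def)
  moreover have "l j = angle (t $ j)" for j using t by (simp add: L_def)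
  ultimately show thesis by (rule that)
qed

text \<open>
  The differences \<open>k j = t' $ j - t $ \<pi> j\<close> are integers that add up to 0. If none is positive, the
  claim is clear. Otherwise some \<open>k q\<close> is negative, hence at most \<open>-1\<close>. As \<open>t'\<close> lies in the
  alcove, no coordinate of \<open>t'\<close> exceeds \<open>t' $ q + 1\<close>, which is at most \<open>t $ \<pi> q\<close>.
\<close>

lemma alcove_top_le:
  assumes "t \<in> alcove" "t' \<in> alcove" and \<pi>: "\<pi> permutes UNIV"
    and ang: "\<And>j. angle (t' $ j) = angle (t $ \<pi> j)"
  shows "top_coord t' \<le> top_coord t"
proof (cases "\<exists>j. t' $ j > t $ \<pi> j")
  case False
  obtain i where "top_coord t' = t' $ i" by (rule top_coord_attained)
  with False coord_le_top[of t "\<pi> i"] show ?thesis by (auto simp: not_less intro: order_trans)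
next
  case True
  define k where "k j = t' $ j - t $ \<pi> j" for j
  have int: "k j \<in> \<int>" for j
    using ang by (simp add: k_def angle_eq_iff)
  have sum_k: "(\<Sum>j\<in>UNIV. k j) = 0"
    using assms(1,2) sum.permute[OF \<pi>, of "($) t"] by (simp add: k_def sum_subtractf alcove_def o_def)
  from True obtain p where "k p > 0" by (auto simp: k_def)
  have "\<exists>q. k q < 0"
  proof (rule ccontr)
    assume "\<nexists>q. k q < 0"
    then have "(\<Sum>j\<in>UNIV. k j) > 0"
      using \<open>k p > 0\<close> by (intro sum_pos2[of _ p]) (auto simp: not_less)
    with sum_k show False by simp
  qed
  then obtain q where "k q < 0" by blast
  with int[of q] have "k q \<le> -1" by (auto elim!: Ints_cases)
  then have "t' $ q \<le> t $ \<pi> q - 1" by (simp add: k_def)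
  moreover have "t' $ i \<le> t' $ q + 1" for i
    using assms(2) by (auto simp: alcove_def diff_le_eq add.commute)
  moreover obtain i where "top_coord t' = t' $ i" by (rule top_coord_attained)
  ultimately have "top_coord t' \<le> t $ \<pi> q" by (smt (verit))
  then show ?thesis using coord_le_top[of t "\<pi> q"] by linarith
qed

lemma alcove_top_unique:
  assumes "t \<in> alcove" "t' \<in> alcove"
    and "splitting X (\<lambda>j. angle (t $ j))" "splitting X (\<lambda>j. angle (t' $ j))"
  shows "top_coord t = top_coord t'"
proof -
  have "top_coord t' \<le> top_coord t"
    if "t \<in> alcove" "t' \<in> alcove"
      "splitting X (\<lambda>j. angle (t $ j))" "splitting X (\<lambda>j. angle (t' $ j))" for t t'
    using splitting_unique[OF that(4,3)] alcove_top_le[OF that(1,2)] by metis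
  from this[OF assms] this[OF assms(2,1,4,3)] show ?thesis by simp
qed

section \<open>The continuous selection\<close>

text \<open>
  The function \<open>s\<close> may be an arbitrary, discontinuous choice. As \<open>h\<close> is constant on the fibres of
  \<open>R\<close>, the preimage of a closed set \<open>B\<close> is the projection of a closed set along the compact set
  \<open>K\<close>, hence closed.
\<close>

lemma continuous_on_fibre_constant:
  fixes h :: "'a::euclidean_space \<Rightarrow> 'c::topological_space"
    and R :: "('a \<times> 'b::euclidean_space) set"
  assumes "compact K" "closed R" and h: "continuous_on K h"
    and sel: "\<And>x. x \<in> S \<Longrightarrow> s x \<in> K \<and> (s x, x) \<in> R"
    and const: "\<And>x t. x \<in> S \<Longrightarrow> t \<in> K \<Longrightarrow> (t, x) \<in> R \<Longrightarrow> h t = h (s x)"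
  shows "continuous_on S (\<lambda>x. h (s x))"
  unfolding continuous_on_closed_invariant
proof (intro allI impI)
  fix B :: "'c set" assume "closed B"
  define A where "A = {x. \<exists>t. t \<in> K \<and> (t, x) \<in> R \<inter> (K \<inter> h -` B) \<times> UNIV}"
  have "closed (K \<inter> h -` B)"
    using h \<open>compact K\<close> \<open>closed B\<close> by (simp add: continuous_closed_preimage compact_imp_closed)
  then have "closed A"
    unfolding A_def using \<open>compact K\<close> \<open>closed R\<close>
    by (intro closed_compact_projection closed_Int[of R] closed_Times) auto
  moreover have "A \<inter> S = (\<lambda>x. h (s x)) -` B \<inter> S"
  proof (intro set_eqI iffI)
    fix x assume "x \<in> A \<inter> S"
    with const[of x] show "x \<in> (\<lambda>x. h (s x)) -` B \<inter> S" by (auto simp: A_def)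
  next
    fix x assume "x \<in> (\<lambda>x. h (s x)) -` B \<inter> S"
    with sel[of x] show "x \<in> A \<inter> S" by (auto simp: A_def)
  qed
  ultimately show "\<exists>A. closed A \<and> A \<inter> S = (\<lambda>x. h (s x)) -` B \<inter> S" by blast
qed

lemma closed_splitting_angles:
  "closed {(t, X :: complex^'n^'n). splitting X (\<lambda>j. angle (t $ j))}"
  unfolding splitting_def angle_def det_def case_prod_beta
  by (simp, intro closed_Collect_all closed_Collect_eq continuous_intros)

lemma eigenvalue_selection_exists:
  "\<exists>\<phi> :: complex^'n^'n \<Rightarrow> complex. continuous_eigenvalue_selection \<phi>"
proof -
  let ?R = "{(t, X :: complex^'n^'n). splitting X (\<lambda>j. angle (t $ j))}"
  have "\<exists>t. t \<in> alcove \<and> (t, X) \<in> ?R" if "X \<in> SU" for X :: "complex^'n^'n"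
  proof -
    have X: "unitary_matrix X" "det X = 1" using that by (auto simp: SU_def)
    obtain l where l: "splitting X l" by (rule splitting_exists)
    have "norm (l j) = 1" for j
      using unitary_spectrum_norm[OF X(1)] splitting_spectrum[OF l] by auto
    moreover have "(\<Prod>j\<in>UNIV. l j) = 1" using splitting_prod[OF l] X(2) by simp
    ultimately obtain t where "t \<in> alcove" "\<And>j. l j = angle (t $ j)"
      using exists_alcove_angles by blast
    moreover from this have "l = (\<lambda>j. angle (t $ j))" by blast
    ultimately show ?thesis using l by blast
  qed
  then obtain s where s: "\<And>X. X \<in> SU \<Longrightarrow> s X \<in> alcove \<and> (s X, X) \<in> ?R"
    by metis
  define \<phi> where "\<phi> X = angle (top_coord (s X))" for X
  have "continuous_on SU \<phi>"
    unfolding \<phi>_def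
  proof (rule continuous_on_fibre_constant[OF compact_alcove closed_splitting_angles _ s])
    show "continuous_on alcove (\<lambda>t :: real^'n. angle (top_coord t))"
      unfolding angle_def by (intro continuous_intros continuous_on_top_coord)
    show "angle (top_coord t) = angle (top_coord (s X))"
      if "X \<in> SU" "t \<in> alcove" "(t, X) \<in> ?R" for X t
      using alcove_top_unique[of t "s X" X] s[OF that(1)] that(2,3) by auto
  qed
  moreover have "\<phi> X \<in> spectrum X" if "X \<in> SU" for X
  proof -
    have "spectrum X = range (\<lambda>j. angle (s X $ j))"
      using s[OF that] splitting_spectrum by auto
    moreover obtain i where "top_coord (s X) = s X $ i" by (rule top_coord_attained)
    ultimately show ?thesis by (simp add: \<phi>_def)
  qed
  ultimately have "continuous_eigenvalue_selection \<phi>"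
    by (auto simp: continuous_eigenvalue_selection_def \<phi>_def angle_def)
  then show ?thesis by blast
qed

section \<open>Scalar matrices\<close>

lemma spectrum_mat: "spectrum (mat c :: complex^'m^'m) = {c}"
proof -
  have "(mat c - mat d :: complex^'m^'m) = mat (c - d)" for d
    by (simp add: vec_eq_iff mat_def)
  then show ?thesis
    by (auto simp: mem_spectrum_iff_det det_diagonal mat_def)
qed

lemma mat_mult_mat: "(mat a :: 'a::semiring_1^'m^'m) ** mat b = mat (a * b)"
  by (simp add: vec_eq_iff matrix_matrix_mult_def mat_def mult_delta_left)

lemma continuous_on_mat:
  assumes "continuous_on S f"
  shows "continuous_on S (\<lambda>x. mat (f x) :: complex^'m^'m)"
  unfolding mat_def
proof (intro continuous_on_vec_lambda)
  show "continuous_on S (\<lambda>x. if i = j then f x else 0)" for i j :: 'm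
    using assms by (cases "i = j") auto
qed

theorem mainTheorem4:
  shows "(\<exists>\<phi> :: complex^'n^'n \<Rightarrow> complex. continuous_eigenvalue_selection \<phi>) \<and>
    (\<forall>\<phi> :: complex^'n^'n \<Rightarrow> complex. continuous_eigenvalue_selection \<phi> \<longrightarrow>
      (let \<Phi> = (\<lambda>X. mat (\<phi> X) :: complex^'m^'m) in
        continuous_on SU \<Phi> \<and> commutativity_preserving \<Phi> \<and> spectrum_shrinking \<Phi>))"
  using eigenvalue_selection_exists
  by (auto simp: Let_def continuous_eigenvalue_selection_def commutativity_preserving_def
      spectrum_shrinking_def spectrum_mat mat_mult_mat mult.commute intro!: continuous_on_mat)

end
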